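(* Let $\alpha>0$ and let $p=p(n)\in[0,1]$ satisfy $p=\omega(n^{-2/3})$, i.e. $p(n)\,n^{2/3}\to\infty$ as $n\to\infty$. For every $n$ let $A=A_n\subseteq [n]$ be a set with $|A|\ge \alpha n$. Then, asymptotically almost surely (i.e. with probability tending to $1$ as $n\to\infty$), the set $A\cup [n]_p$ has the property that every $2$-colouring of its elements admits a monochromatic Schur triple.
   Context: $[n]:=\{1,2,\ldots,n\}$. $[n]_p$ denotes the random subset of $[n]$ in which each element of $[n]$ is included independently with probability $p$. A Schur triple is a triple of integers $(x,y,z)$ with $x+y=z$ (the integers $x$ and $y$ are not required to be distinct). A monochromatic Schur triple in a coloured set of integers is a Schur triple all of whose entries lie in the set and have the same colour. *)

theory Defs
  imports "HOL-Probability.Probability" "HOL-Probability.Product_PMF"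
begin

definition binomial_random_subset :: "nat \<Rightarrow> real \<Rightarrow> nat set pmf" where
  "binomial_random_subset n p =
     map_pmf (\<lambda>f. {k \<in> {1..n}. f k}) (Pi_pmf {1..n} False (\<lambda>_. bernoulli_pmf p))"

(* All sets of integers considered consist of positive integers, so triples are taken over nat. *)
definition schur_triple :: "nat \<Rightarrow> nat \<Rightarrow> nat \<Rightarrow> bool" where
  "schur_triple x y z \<longleftrightarrow> x + y = z"

definition has_mono_schur_triple :: "nat set \<Rightarrow> (nat \<Rightarrow> 'c) \<Rightarrow> bool" where
  "has_mono_schur_triple S c \<longleftrightarrow>
     (\<exists>x\<in>S. \<exists>y\<in>S. \<exists>z\<in>S. schur_triple x y z \<and> c x = c y \<and> c y = c z)"

(* A 2-colouring of S is given by a colouring of all of nat; its values outside S play no role. *)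
definition two_colour_schur :: "nat set \<Rightarrow> bool" where
  "two_colour_schur S \<longleftrightarrow> (\<forall>c :: nat \<Rightarrow> bool. has_mono_schur_triple S c)"

end

theory Submission
  imports Defs "HOL-Real_Asymp.Real_Asymp"
begin

text \<open>
  Fix a dense set \<open>A\<close>. For a pair \<open>(x, y)\<close> consider the set \<open>B\<close> of base points \<open>a\<close> of the
  parallelograms \<open>a, a + x, a + y, a + x + y\<close> inside \<open>A\<close>. The proof rests on a colouring fact:
  if \<open>x\<close>, \<open>y\<close>, \<open>x + y\<close> are present together with \<open>A\<close>, then every colouring without a monochromatic
  Schur triple makes a whole translate \<open>B + d\<close>, contained in \<open>A\<close>, monochromatic, say of colour \<open>k\<close>
  (\<open>box_corners_translate_monochromatic\<close>). Any further element \<open>w\<close> that is a difference of two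
  elements of \<open>B\<close> is then forced to avoid the colour \<open>k\<close>. Hence a second Schur triple
  \<open>u, v, u + v\<close> whose entries are all differences of elements of \<open>B\<close> would itself be monochromatic,
  and no good colouring exists (\<open>two_nested_boxes_imp_schur\<close>). It is enough that \<open>B\<close> contains a
  parallelogram with sides \<open>u\<close> and \<open>v\<close>.

  Both triples come from the random set, by one and the same step. Two applications of the
  pigeonhole principle to differences show that a dense set \<open>A\<close> has a positive proportion of
  all pairs \<open>(x, y)\<close> for which \<open>B\<close> is again dense (\<open>many_popular_pairs\<close>). There are then about
  \<open>n^2\<close> suitable triples, each contained in the random set with probability \<open>p^3\<close>. Their expected
  number \<open>n^2 p^3\<close> tends to infinity exactly because \<open>p\<close> dominates \<open>n^(-2/3)\<close>, and the second moment
  method (\<open>prob_no_schur_triple_le\<close>) provides one of them with high probability.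

  The second step must be applied to the set \<open>B\<close> found in the first, which depends on the random
  set. To keep randomness fresh, the random set is written as the union of two independent random
  sets of density \<open>q\<close>, where \<open>(1 - q)^2 = 1 - p\<close>
  (\<open>binomial_random_subset_two_rounds\<close>). The first round supplies \<open>(x, y)\<close>; since \<open>B\<close> is dense, the
  second round supplies \<open>(u, v)\<close>.
\<close>

section \<open>Colourings and parallelograms\<close>

definition box_corners :: "nat set \<Rightarrow> nat \<Rightarrow> nat \<Rightarrow> nat set" where
  "box_corners A x y = {a. a \<in> A \<and> a + x \<in> A \<and> a + y \<in> A \<and> a + x + y \<in> A}"

lemma box_corners_subset: "box_corners A x y \<subseteq> A"
  by (auto simp: box_corners_def)

lemma no_mono_triple:
  assumes "\<not> has_mono_schur_triple S c" "u \<in> S" "v \<in> S" "u + v \<in> S"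
  shows "\<not> (c u = c v \<and> c v = c (u + v))"
  using assms unfolding has_mono_schur_triple_def schur_triple_def by blast

text \<open>
  In a colouring without monochromatic Schur triple, the three elements \<open>x\<close>, \<open>y\<close>, \<open>x + y\<close> do not
  have the same colour, so one of them carries the minority colour \<open>k\<close>. Two points of \<open>A\<close> at
  distance \<open>w\<close> cannot both have the colour of \<open>w\<close>. In a parallelogram of \<open>A\<close> with sides \<open>x\<close> and
  \<open>y\<close> these constraints force the colour \<open>k\<close> on two opposite corners: on \<open>a\<close> and \<open>a + x + y\<close> if \<open>x\<close> or
  \<open>y\<close> is the minority element, and on \<open>a + x\<close> and \<open>a + y\<close> if \<open>x + y\<close> is. The shift \<open>d\<close> selects one
  of the forced corners and does not depend on the parallelogram.
\<close>
lemma box_corners_translate_monochromatic: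
  fixes c :: "nat \<Rightarrow> bool"
  assumes c: "\<not> has_mono_schur_triple S c" and A: "A \<subseteq> S"
    and xy: "x \<in> S" "y \<in> S" "x + y \<in> S"
  obtains d k where "\<And>a. a \<in> box_corners A x y \<Longrightarrow> a + d \<in> A \<and> c (a + d) = k"
proof (cases "c x = c y")
  case True
  hence k: "c (x + y) \<noteq> c x" using no_mono_triple[OF c xy] by auto
  have "a + x \<in> A \<and> c (a + x) = c (x + y)" if a: "a \<in> box_corners A x y" for a
  proof -
    have in_A: "a \<in> A" "a + x \<in> A" "a + y \<in> A" "a + x + y \<in> A"
      using a by (auto simp: box_corners_def)
    have "\<not> (c a = c x \<and> c x = c (a + x))" "\<not> (c a = c (x + y) \<and> c (x + y) = c (a + x + y))"
      "\<not> (c (a + x) = c y \<and> c y = c (a + x + y))"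
      using no_mono_triple[OF c, of a x] no_mono_triple[OF c, of a "x + y"]
        no_mono_triple[OF c, of "a + x" y] in_A A xy by (auto simp: add.assoc)
    with in_A True k show ?thesis by auto
  qed
  thus ?thesis using that by blast
next
  case False
  define k where "k = (if c (x + y) = c x then c y else c x)"
  have "a + 0 \<in> A \<and> c (a + 0) = k" if a: "a \<in> box_corners A x y" for a
  proof -
    have in_A: "a \<in> A" "a + x \<in> A" "a + y \<in> A" "a + x + y \<in> A"
      using a by (auto simp: box_corners_def)
    have "\<not> (c a = c x \<and> c x = c (a + x))" "\<not> (c a = c y \<and> c y = c (a + y))"
      "\<not> (c a = c (x + y) \<and> c (x + y) = c (a + x + y))"
      "\<not> (c (a + x) = c y \<and> c y = c (a + x + y))" "\<not> (c (a + y) = c x \<and> c x = c (a + x + y))"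
      using no_mono_triple[OF c, of a x] no_mono_triple[OF c, of a y]
        no_mono_triple[OF c, of a "x + y"] no_mono_triple[OF c, of "a + x" y]
        no_mono_triple[OF c, of "a + y" x] in_A A xy by (auto simp: add.assoc add.commute[of y x])
    with in_A False show ?thesis by (auto simp: k_def)
  qed
  thus ?thesis using that by blast
qed

text \<open>
  The elements \<open>u\<close>, \<open>v\<close>, \<open>u + v\<close> are differences of points of \<open>box_corners A x y\<close>, hence
  also of its monochromatic translate. All three must avoid the colour of that translate, which
  leaves one colour for the whole triple.
\<close>
lemma two_nested_boxes_imp_schur:
  assumes A: "A \<subseteq> S"
    and xy: "x \<in> S" "y \<in> S" "x + y \<in> S"
    and uv: "u \<in> S" "v \<in> S" "u + v \<in> S"
    and ne: "box_corners (box_corners A x y) u v \<noteq> {}"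
  shows "two_colour_schur S"
  unfolding two_colour_schur_def
proof (intro allI, rule ccontr)
  fix c :: "nat \<Rightarrow> bool"
  assume c: "\<not> has_mono_schur_triple S c"
  obtain d k where dk: "\<And>a. a \<in> box_corners A x y \<Longrightarrow> a + d \<in> A \<and> c (a + d) = k"
    using box_corners_translate_monochromatic[OF c A xy] by blast
  obtain b where b: "b \<in> box_corners A x y" "b + u \<in> box_corners A x y"
      "b + v \<in> box_corners A x y" "b + u + v \<in> box_corners A x y"
    using ne by (auto simp: box_corners_def[of "box_corners A x y"])
  have diff: "c w \<noteq> k" if "w \<in> S" "b + w \<in> box_corners A x y" for w
  proof -
    have "b + w + d = (b + d) + w" by simp
    moreover have "b + d \<in> S" "c (b + d) = k" "b + w + d \<in> S" "c (b + w + d) = k"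
      using dk[OF b(1)] dk[OF that(2)] A by blast+
    ultimately have "b + d \<in> S" "c (b + d) = k" "b + d + w \<in> S" "c (b + d + w) = k"
      by metis+
    thus ?thesis using no_mono_triple[OF c _ that(1)] by metis
  qed
  have "c u \<noteq> k" "c v \<noteq> k" "c (u + v) \<noteq> k"
    using diff uv b by (auto simp: add.assoc)
  with no_mono_triple[OF c uv] show False by auto
qed

section \<open>Dense sets contain many parallelograms\<close>

text \<open>
  Ordered pairs of elements of \<open>A\<close> are counted by their difference; the last term accounts for the
  pairs with equal entries.
\<close>
lemma card_square_le_differences:
  assumes A: "A \<subseteq> {1..n::nat}"
  shows "card A ^ 2 \<le> 2 * (\<Sum>d\<in>{1..n}. card {a \<in> A. a + d \<in> A}) + card A"
proof -
  have fin: "finite A" using A finite_subset by blast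
  define L where "L = Sigma {1..n} (\<lambda>d. {a \<in> A. a + d \<in> A})"
  have finL: "finite L" using fin by (auto simp: L_def)
  have cov: "A \<times> A \<subseteq> (\<lambda>(d,a). (a, a + d)) ` L \<union> (\<lambda>(d,a). (a + d, a)) ` L \<union> (\<lambda>a. (a,a)) ` A"
  proof clarify
    fix a b assume ab: "a \<in> A" "b \<in> A"
      and n1: "(a, b) \<notin> (\<lambda>a. (a, a)) ` A" and n2: "(a, b) \<notin> (\<lambda>(d, a). (a + d, a)) ` L"
    consider "a = b" | "a < b" | "b < a" by linarith
    thus "(a, b) \<in> (\<lambda>(d, a). (a, a + d)) ` L"
    proof cases
      case 1 thus ?thesis using n1 ab by auto
    next
      case 2
      have "(b - a, a) \<in> L" using ab A 2 by (auto simp: L_def)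
      thus ?thesis using 2 by (force intro!: image_eqI)
    next
      case 3
      have "(a - b, b) \<in> L" using ab A 3 by (auto simp: L_def)
      thus ?thesis using 3 n2 by (force intro!: image_eqI)
    qed
  qed
  have "card (A \<times> A) \<le> card ((\<lambda>(d,a). (a, a + d)) ` L) + card ((\<lambda>(d,a). (a + d, a)) ` L) + card ((\<lambda>a. (a,a)) ` A)"
    using card_mono[OF _ cov] finL fin
    by (meson card_Un_le finite_UnI finite_imageI le_trans add_le_mono le_refl)
  also have "\<dots> \<le> card L + card L + card A"
    by (intro add_mono card_image_le finL fin)
  also have "card L = (\<Sum>d\<in>{1..n}. card {a \<in> A. a + d \<in> A})"
    unfolding L_def using fin by (subst card_SigmaI) auto
  finally show ?thesis by (simp add: card_cartesian_product power2_eq_square)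
qed

text \<open>
  If there were fewer than \<open>\<alpha>\<^sup>2 / 8 * n\<close> popular differences, then these, representing at most
  \<open>n\<close> pairs each, and the unpopular ones, at most \<open>n\<close> in number, would represent fewer than
  \<open>(\<alpha> * n)\<^sup>2 / 4\<close> pairs altogether. But once \<open>A\<close> has at least two elements, the number of pairs
  \<open>a < b\<close> in \<open>A\<close> is at least a quarter of the square of its size.
\<close>
lemma many_popular_differences:
  fixes \<alpha> :: real
  assumes A: "A \<subseteq> {1..n::nat}" and "\<alpha> > 0" and dens: "real (card A) \<ge> \<alpha> * n" and large: "\<alpha> * n \<ge> 2"
  shows "real (card {d \<in> {1..n}. real (card {a \<in> A. a + d \<in> A}) \<ge> \<alpha>\<^sup>2 / 8 * n}) \<ge> \<alpha>\<^sup>2 / 8 * n"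
proof (rule ccontr)
  define D where "D = {d \<in> {1..n}. real (card {a \<in> A. a + d \<in> A}) \<ge> \<alpha>\<^sup>2 / 8 * n}"
  assume "\<not> ?thesis"
  hence D: "real (card D) < \<alpha>\<^sup>2 / 8 * n" by (simp add: D_def)
  have npos: "real n > 0" using large \<open>\<alpha> > 0\<close> by (cases n) auto
  have finA: "finite A" using A finite_subset by blast
  have "card A \<le> n" using card_mono[OF _ A] by simp
  have "real (card {a \<in> A. a + d \<in> A}) \<le> (if d \<in> D then real n else 0) + \<alpha>\<^sup>2 / 8 * n" if "d \<in> {1..n}" for d
  proof (cases "d \<in> D")
    case True
    have "card {a \<in> A. a + d \<in> A} \<le> card A" by (intro card_mono finA) auto
    hence "real (card {a \<in> A. a + d \<in> A}) \<le> real n" using \<open>card A \<le> n\<close> by linarith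
    thus ?thesis using True by (simp add: add_increasing2)
  next
    case False
    thus ?thesis using that by (auto simp: D_def)
  qed
  hence "(\<Sum>d\<in>{1..n}. real (card {a \<in> A. a + d \<in> A})) \<le> (\<Sum>d\<in>{1..n}. (if d \<in> D then real n else 0) + \<alpha>\<^sup>2 / 8 * n)"
    by (intro sum_mono) auto
  also have "\<dots> = card D * real n + \<alpha>\<^sup>2 / 8 * n * n"
  proof -
    have "{1..n} \<inter> D = D" by (auto simp: D_def)
    thus ?thesis by (simp add: sum.distrib sum.If_cases)
  qed
  also have "\<dots> < \<alpha>\<^sup>2 / 8 * n * n + \<alpha>\<^sup>2 / 8 * n * n"
    using D npos by (intro add_strict_right_mono mult_strict_right_mono) auto
  finally have up: "(\<Sum>d\<in>{1..n}. real (card {a \<in> A. a + d \<in> A})) < (\<alpha> * n)\<^sup>2 / 4"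
    by (simp add: power2_eq_square mult_ac)
  have "real (card A ^ 2) \<le> real (2 * (\<Sum>d\<in>{1..n}. card {a \<in> A. a + d \<in> A}) + card A)"
    using card_square_le_differences[OF A] by (simp only: of_nat_le_iff)
  hence lo: "real (card A) ^ 2 \<le> 2 * (\<Sum>d\<in>{1..n}. real (card {a \<in> A. a + d \<in> A})) + card A"
    by simp
  have "real (card A) \<ge> 2" using dens large by linarith
  hence "2 * real (card A) \<le> (real (card A))\<^sup>2" by (simp add: power2_eq_square mult_right_mono)
  moreover have "(\<alpha> * n)\<^sup>2 \<le> (real (card A))\<^sup>2" using dens \<open>\<alpha> > 0\<close> by (intro power_mono) auto
  ultimately show False using lo up by linarith
qed

text \<open>
  The condition \<open>x \<noteq> y\<close> ensures that the triple \<open>x, y, x + y\<close> has three different entries, so that it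
  lies in a random set of density \<open>q\<close> with probability exactly \<open>q ^ 3\<close>.
\<close>
definition popular_pairs :: "nat \<Rightarrow> real \<Rightarrow> nat set \<Rightarrow> (nat \<times> nat) set" where
  "popular_pairs n \<gamma> A =
     {(x, y). 1 \<le> x \<and> 1 \<le> y \<and> x \<noteq> y \<and> x + y \<le> n \<and> real (card (box_corners A x y)) \<ge> \<gamma> * n}"

text \<open>
  The base points of parallelograms with sides \<open>x\<close> and \<open>y\<close> are obtained by passing from \<open>A\<close> to
  \<open>A \<inter> (A - x)\<close> and then doing the same with \<open>y\<close>. For popular \<open>x\<close> the intermediate set is
  dense, so it has many popular differences \<open>y\<close> in turn. A single constant \<open>\<gamma>\<close> bounds both the
  density of the resulting sets and the proportion of such pairs; it does not depend on \<open>A\<close>, so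
  that the lemma can be applied to a set that is itself random.
\<close>
lemma many_popular_pairs:
  fixes \<alpha> :: real
  assumes "\<alpha> > 0"
  obtains \<gamma> N where "\<gamma> > 0"
    "\<And>n A. n \<ge> N \<Longrightarrow> A \<subseteq> {1..n} \<Longrightarrow> real (card A) \<ge> \<alpha> * n \<Longrightarrow>
       real (card (popular_pairs n \<gamma> A)) \<ge> \<gamma> * (real n)\<^sup>2"
proof -
  define \<beta> where "\<beta> = \<alpha>\<^sup>2 / 8"
  define \<delta> where "\<delta> = \<beta>\<^sup>2 / 8"
  define \<gamma> where "\<gamma> = min \<delta> (\<beta> * \<delta> / 2)"
  have pos: "\<beta> > 0" "\<delta> > 0" "\<gamma> > 0" using assms by (auto simp: \<beta>_def \<delta>_def \<gamma>_def)
  (* The first two terms make A and the intermediate sets large enough for the pigeonhole step;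
     the third makes the n diagonal pairs at most half of all pairs found. *)
  define N where "N = nat \<lceil>max (2 / \<alpha>) (max (2 / \<beta>) (2 / (\<beta> * \<delta>)))\<rceil> + 1"
  have main: "real (card (popular_pairs n \<gamma> A)) \<ge> \<gamma> * (real n)\<^sup>2"
    if n: "n \<ge> N" and A: "A \<subseteq> {1..n}" and dens: "real (card A) \<ge> \<alpha> * n" for n A
  proof -
    have "real n \<ge> max (2 / \<alpha>) (max (2 / \<beta>) (2 / (\<beta> * \<delta>)))" "real n > 0"
      using n unfolding N_def by linarith+
    hence lg: "\<alpha> * n \<ge> 2" "\<beta> * n \<ge> 2" "\<beta> * \<delta> * n \<ge> 2"
      using assms pos by (auto simp: field_simps)
    define B where "B d = {a \<in> A. a + d \<in> A}" for d
    define D where "D = {d \<in> {1..n}. real (card (B d)) \<ge> \<beta> * n}"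
    define E where "E d = {e \<in> {1..n}. real (card {a \<in> B d. a + e \<in> B d}) \<ge> \<delta> * n}" for d
    have D: "real (card D) \<ge> \<beta> * n"
      using many_popular_differences[OF A assms dens lg(1)] by (simp add: D_def B_def \<beta>_def)
    have E: "real (card (E d)) \<ge> \<delta> * n" if "d \<in> D" for d
      using many_popular_differences[of "B d" n \<beta>] that A lg(2) pos
      by (auto simp: D_def E_def B_def \<delta>_def)
    have box: "{a \<in> B d. a + e \<in> B d} = box_corners A d e" for d e
      by (auto simp: B_def box_corners_def algebra_simps)
    have sub: "Sigma D E \<subseteq> popular_pairs n \<gamma> A \<union> (\<lambda>d. (d, d)) ` {1..n}"
    proof clarify
      fix d e assume d: "d \<in> D" and e: "e \<in> E d" and ne: "(d, e) \<notin> (\<lambda>d. (d, d)) ` {1..n}"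
      have card: "real (card (box_corners A d e)) \<ge> \<delta> * n"
        using e by (simp add: E_def box)
      hence "card (box_corners A d e) > 0"
        using pos \<open>real n > 0\<close> by (smt (verit) mult_pos_pos of_nat_0_less_iff)
      then obtain a where "a \<in> box_corners A d e" by (auto simp: card_gt_0_iff)
      hence "a + d + e \<in> A" by (simp add: box_corners_def)
      hence "d + e \<le> n" using A by fastforce
      moreover have "\<gamma> * n \<le> \<delta> * n" by (intro mult_right_mono) (auto simp: \<gamma>_def)
      ultimately have "d + e \<le> n" "\<gamma> * n \<le> card (box_corners A d e)" using card by linarith+
      thus "(d, e) \<in> popular_pairs n \<gamma> A"
        using d e ne by (auto simp: popular_pairs_def D_def E_def)
    qed
    have fin: "finite (popular_pairs n \<gamma> A)"
      by (rule finite_subset[of _ "{1..n} \<times> {1..n}"]) (auto simp: popular_pairs_def)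
    have "card (Sigma D E) \<le> card (popular_pairs n \<gamma> A) + card ((\<lambda>d. (d, d)) ` {1..n})"
      using card_mono[OF _ sub] fin by (meson card_Un_le finite_UnI finite_imageI finite_atLeastAtMost le_trans)
    also have "\<dots> \<le> card (popular_pairs n \<gamma> A) + n"
      using card_image_le[of "{1..n}" "\<lambda>d. (d, d)"] by simp
    finally have "real (card (Sigma D E)) \<le> card (popular_pairs n \<gamma> A) + real n" by linarith
    moreover have "real (card (Sigma D E)) \<ge> \<beta> * n * (\<delta> * n)"
    proof -
      have "\<beta> * n * (\<delta> * n) \<le> card D * (\<delta> * n)"
        using D pos by (intro mult_right_mono) auto
      also have "\<dots> = (\<Sum>d\<in>D. \<delta> * n)" by simp
      also have "\<dots> \<le> (\<Sum>d\<in>D. real (card (E d)))" by (intro sum_mono E)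
      also have "\<dots> = card (Sigma D E)" by (subst card_SigmaI) (auto simp: D_def E_def)
      finally show ?thesis .
    qed
    moreover have "\<beta> * n * (\<delta> * n) - n \<ge> \<beta> * \<delta> / 2 * n\<^sup>2"
      using mult_right_mono[OF lg(3), of "real n"] by (simp add: power2_eq_square algebra_simps)
    moreover have "\<gamma> * (real n)\<^sup>2 \<le> \<beta> * \<delta> / 2 * n\<^sup>2"
      unfolding of_nat_power by (intro mult_right_mono) (auto simp: \<gamma>_def)
    ultimately show ?thesis by (simp add: algebra_simps)
  qed
  show ?thesis using that[OF pos(3) main] .
qed

section \<open>The second moment method for Schur triples\<close>

lemma prob_subset_binomial_random_subset:
  assumes "T \<subseteq> {1..n}" "q \<in> {0..1}"
  shows "measure_pmf.prob (binomial_random_subset n q) {R. T \<subseteq> R} = q ^ card T"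
proof -
  have "measure_pmf.prob (binomial_random_subset n q) {R. T \<subseteq> R} =
      measure_pmf.prob (Pi_pmf {1..n} False (\<lambda>_. bernoulli_pmf q))
        {f. \<forall>k\<in>T. f k}"
    unfolding binomial_random_subset_def using assms(1)
    by (simp add: vimage_def) (intro arg_cong2[where f = measure] refl, auto)
  also have "{f. \<forall>k\<in>T. f k} = Pi {1..n} (\<lambda>k. if k \<in> T then {True} else UNIV)"
    using assms(1) by (auto simp: Pi_def)
  also have "measure_pmf.prob (Pi_pmf {1..n} False (\<lambda>_. bernoulli_pmf q)) \<dots> =
      (\<Prod>k\<in>{1..n}. if k \<in> T then q else 1)"
    using assms(2)
    by (subst measure_Pi_pmf_Pi) (auto intro!: prod.cong simp: measure_pmf_single)
  also have "\<dots> = q ^ card T"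
    using assms(1) by (simp add: prod.If_cases Int_absorb1)
  finally show ?thesis .
qed

text \<open>
  Let \<open>X\<close> be the number of the events that occur. Where none occurs, \<open>(X - \<mu>)\<^sup>2\<close> equals \<open>\<mu>\<^sup>2\<close>, so
  the left-hand side is at most the variance of \<open>X\<close>, which is the right-hand side.
\<close>
lemma second_moment_bound:
  fixes E :: "'i \<Rightarrow> 'a set" and M :: "'a pmf"
  assumes fin: "finite S"
  defines "\<mu> \<equiv> (\<Sum>i\<in>S. measure_pmf.prob M (E i))"
  shows "\<mu>\<^sup>2 * measure_pmf.prob M {w. \<forall>i\<in>S. w \<notin> E i} \<le>
     (\<Sum>i\<in>S. \<Sum>j\<in>S. measure_pmf.prob M (E i \<inter> E j)) - \<mu>\<^sup>2"
proof -
  define X where "X w = (\<Sum>i\<in>S. indicator (E i) w :: real)" for w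
  have XX: "X w * X w = (\<Sum>i\<in>S. \<Sum>j\<in>S. indicator (E i \<inter> E j) w)" for w
    by (simp add: X_def sum_product indicator_inter_arith)
  have int: "integrable (measure_pmf M) (indicator B :: _ \<Rightarrow> real)" for B :: "'a set"
    by (simp add: measure_pmf.emeasure_eq_measure)
  have intX: "integrable (measure_pmf M) X" unfolding X_def by (intro Bochner_Integration.integrable_sum int)
  have intXX: "integrable (measure_pmf M) (\<lambda>w. X w * X w)"
    unfolding XX by (intro Bochner_Integration.integrable_sum int)
  have "\<mu>\<^sup>2 * measure_pmf.prob M {w. \<forall>i\<in>S. w \<notin> E i} =
      measure_pmf.expectation M (\<lambda>w. \<mu>\<^sup>2 * indicator {w. \<forall>i\<in>S. w \<notin> E i} w)"
    by simp
  also have "\<dots> \<le> measure_pmf.expectation M (\<lambda>w. X w * X w - 2 * \<mu> * X w + \<mu>\<^sup>2)"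
  proof (rule integral_mono)
    show "integrable (measure_pmf M) (\<lambda>w. \<mu>\<^sup>2 * indicator {w. \<forall>i\<in>S. w \<notin> E i} w)"
      by (intro integrable_mult_right int)
    show "integrable (measure_pmf M) (\<lambda>w. X w * X w - 2 * \<mu> * X w + \<mu>\<^sup>2)"
      by (intro Bochner_Integration.integrable_add Bochner_Integration.integrable_diff
          integrable_mult_right intX intXX) simp
    fix w
    have "X w * X w - 2 * \<mu> * X w + \<mu>\<^sup>2 = (X w - \<mu>)\<^sup>2" by (simp add: power2_eq_square algebra_simps)
    moreover have "X w = 0" if "\<forall>i\<in>S. w \<notin> E i" using that by (simp add: X_def)
    ultimately show "\<mu>\<^sup>2 * indicator {w. \<forall>i\<in>S. w \<notin> E i} w \<le> X w * X w - 2 * \<mu> * X w + \<mu>\<^sup>2"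
      by (auto simp: indicator_def)
  qed
  also have "\<dots> = measure_pmf.expectation M (\<lambda>w. X w * X w) - 2 * \<mu> * measure_pmf.expectation M X + \<mu>\<^sup>2"
    using intX intXX by simp
  also have "measure_pmf.expectation M X = \<mu>"
    unfolding X_def \<mu>_def by (subst Bochner_Integration.integral_sum) (auto intro: int)
  also have "measure_pmf.expectation M (\<lambda>w. X w * X w) = (\<Sum>i\<in>S. \<Sum>j\<in>S. measure_pmf.prob M (E i \<inter> E j))"
    unfolding XX by (simp add: Bochner_Integration.integral_sum int)
  finally show ?thesis by (simp add: power2_eq_square)
qed

definition schur_support :: "nat \<times> nat \<Rightarrow> nat set" where
  "schur_support = (\<lambda>(x, y). {x, y, x + y})"

lemma card_schur_support:
  assumes "1 \<le> fst t" "1 \<le> snd t" "fst t \<noteq> snd t"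
  shows "card (schur_support t) = 3"
  using assms by (cases t) (auto simp: schur_support_def card_insert_if)

text \<open>
  The next two lemmas count the triples that are correlated with a given one. Prescribing one
  entry of a Schur triple leaves one degree of freedom, prescribing two entries leaves none; the
  constants come from the choice of the positions and of the prescribed values.
\<close>
lemma card_triples_meeting:
  assumes S: "S \<subseteq> {1..n} \<times> {1..n}" and T: "card T \<le> 3" "finite T"
  shows "card {t \<in> S. schur_support t \<inter> T \<noteq> {}} \<le> 9 * n"
proof -
  let ?U = "T \<times> {1..n} \<union> (\<lambda>(i, k). (k, i)) ` (T \<times> {1..n}) \<union>
    (\<lambda>(i, k). (k, i - k)) ` (T \<times> {1..n})"
  have sub: "{t \<in> S. schur_support t \<inter> T \<noteq> {}} \<subseteq> ?U"
  proof
    fix t assume "t \<in> {t \<in> S. schur_support t \<inter> T \<noteq> {}}"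
    then obtain x y where t: "t = (x, y)" "x \<in> {1..n}" "y \<in> {1..n}"
      "x \<in> T \<or> y \<in> T \<or> x + y \<in> T"
      using S by (cases t) (auto simp: schur_support_def)
    from t(4) consider "x \<in> T" | "y \<in> T" | "x + y \<in> T" by blast
    thus "t \<in> ?U"
    proof cases
      case 1 thus ?thesis using t by simp
    next
      case 2 thus ?thesis using t by (intro UnI1 UnI2 rev_image_eqI[of "(y, x)"]) auto
    next
      case 3 thus ?thesis using t by (intro UnI2 rev_image_eqI[of "(x + y, x)"]) auto
    qed
  qed
  have "card {t \<in> S. schur_support t \<inter> T \<noteq> {}} \<le> card ?U"
    using T by (intro card_mono[OF _ sub]) auto
  also have "\<dots> \<le> card (T \<times> {1..n}) + card (T \<times> {1..n}) + card (T \<times> {1..n})"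
    using T by (intro order_trans[OF card_Un_le] add_mono card_image_le) auto
  also have "card (T \<times> {1..n}) = card T * n" by (simp add: card_cartesian_product)
  also have "card T * n + card T * n + card T * n \<le> 9 * n"
    using mult_le_mono1[OF T(1), of n] by linarith
  finally show ?thesis .
qed

lemma card_triples_meeting_twice:
  assumes T: "card T \<le> 3" "finite T"
  shows "card {t \<in> S. card (schur_support t \<inter> T) \<ge> 2} \<le> 27"
proof -
  let ?U = "T \<times> T \<union> (\<lambda>(i, k). (i, k - i)) ` (T \<times> T) \<union>
    (\<lambda>(i, k). (k - i, i)) ` (T \<times> T)"
  have sub: "{t \<in> S. card (schur_support t \<inter> T) \<ge> 2} \<subseteq> ?U"
  proof
    fix t assume t: "t \<in> {t \<in> S. card (schur_support t \<inter> T) \<ge> 2}"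
    obtain x y where xy: "t = (x, y)" by (cases t)
    have "\<not> (\<exists>z. schur_support t \<inter> T \<subseteq> {z})"
    proof
      assume "\<exists>z. schur_support t \<inter> T \<subseteq> {z}"
      then obtain z where "schur_support t \<inter> T \<subseteq> {z}" by blast
      hence "card (schur_support t \<inter> T) \<le> card {z}" by (intro card_mono) auto
      thus False using t by auto
    qed
    hence "x \<in> T \<and> y \<in> T \<or> x \<in> T \<and> x + y \<in> T \<or> y \<in> T \<and> x + y \<in> T"
      unfolding xy schur_support_def by auto
    then consider "x \<in> T" "y \<in> T" | "x \<in> T" "x + y \<in> T" | "y \<in> T" "x + y \<in> T" by blast
    thus "t \<in> ?U"
    proof cases
      case 1 thus ?thesis using xy by simp
    next
      case 2 thus ?thesis using xy by (intro UnI1 UnI2 rev_image_eqI[of "(x, x + y)"]) auto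
    next
      case 3 thus ?thesis using xy by (intro UnI2 rev_image_eqI[of "(y, x + y)"]) auto
    qed
  qed
  have "card {t \<in> S. card (schur_support t \<inter> T) \<ge> 2} \<le> card ?U"
    using T by (intro card_mono[OF _ sub]) auto
  also have "\<dots> \<le> card (T \<times> T) + card (T \<times> T) + card (T \<times> T)"
    using T by (intro order_trans[OF card_Un_le] add_mono card_image_le) auto
  also have "\<dots> \<le> 27" using mult_le_mono[OF T(1) T(1)] by (simp add: card_cartesian_product)
  finally show ?thesis .
qed

text \<open>
  Two Schur triples with \<open>m\<close> common entries are both present with probability \<open>q ^ (6 - m)\<close>. The
  pairs with \<open>m = 0\<close> contribute at most the squared mean. By the counts above, the others add at
  most \<open>9 n q ^ 5\<close> for \<open>m = 1\<close> and \<open>27 q ^ 3\<close> for \<open>m \<ge> 2\<close> to each row of the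
  double sum. Dividing by the squared mean \<open>(card S)\<^sup>2 q ^ 6\<close> gives the two terms of the bound.
\<close>
lemma prob_no_schur_triple_le:
  fixes q \<gamma> :: real
  assumes S: "\<And>x y. (x, y) \<in> S \<Longrightarrow> 1 \<le> x \<and> 1 \<le> y \<and> x \<noteq> y \<and> x + y \<le> n"
    and q: "0 < q" "q \<le> 1" and "\<gamma> > 0" and n: "n > 0" and card_S: "real (card S) \<ge> \<gamma> * (real n)\<^sup>2"
  shows "measure_pmf.prob (binomial_random_subset n q) {R. \<forall>t\<in>S. \<not> schur_support t \<subseteq> R}
     \<le> (27 / ((real n)\<^sup>2 * q ^ 3) + 9 / (n * q)) / \<gamma>"
proof -
  let ?P = "measure_pmf.prob (binomial_random_subset n q)"
  define s where "s = real (card S)"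
  have S_box: "S \<subseteq> {1..n} \<times> {1..n}" using S by force
  have finS: "finite S" by (rule finite_subset[OF S_box]) auto
  have "\<gamma> * (real n)\<^sup>2 > 0" using \<open>\<gamma> > 0\<close> n by simp
  hence s: "s > 0" "s \<ge> \<gamma> * (real n)\<^sup>2" using card_S unfolding s_def by linarith+
  have c3: "card (schur_support t) = 3" "schur_support t \<subseteq> {1..n}" "finite (schur_support t)" if "t \<in> S" for t
    using S[of "fst t" "snd t"] that card_schur_support[of t] by (auto simp: schur_support_def split_beta)
  have Pt: "?P {R. schur_support t \<subseteq> R} = q ^ 3" if "t \<in> S" for t
    using prob_subset_binomial_random_subset[of "schur_support t" n q] c3[OF that] q by simp
  have row: "(\<Sum>u\<in>S. ?P ({R. schur_support t \<subseteq> R} \<inter> {R. schur_support u \<subseteq> R}))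
      \<le> s * q ^ 6 + 9 * n * q ^ 5 + 27 * q ^ 3" if t: "t \<in> S" for t
  proof -
    have "?P ({R. schur_support t \<subseteq> R} \<inter> {R. schur_support u \<subseteq> R}) \<le>
        q ^ 6 + (if schur_support u \<inter> schur_support t \<noteq> {} then q ^ 5 else 0)
          + (if card (schur_support u \<inter> schur_support t) \<ge> 2 then q ^ 3 else 0)" (is "?l \<le> ?r") if u: "u \<in> S" for u
    proof -
      let ?m = "card (schur_support u \<inter> schur_support t)"
      have "?l = ?P {R. schur_support t \<union> schur_support u \<subseteq> R}" by (simp add: Int_def)
      also have "\<dots> = q ^ card (schur_support t \<union> schur_support u)"
        using c3[OF t] c3[OF u] q by (intro prob_subset_binomial_random_subset) auto
      finally have l: "?l = q ^ card (schur_support t \<union> schur_support u)" .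
      have m: "card (schur_support t \<union> schur_support u) + ?m = 6"
        using card_Un_Int[of "schur_support t" "schur_support u"] c3[OF t] c3[OF u] by (simp add: Int_commute)
      have "?m \<le> 3" using card_mono[of "schur_support t" "schur_support u \<inter> schur_support t"] c3[OF t] by simp
      consider "?m = 0" | "?m = 1" | "?m \<ge> 2" by linarith
      thus ?thesis
      proof cases
        case 1
        hence "card (schur_support t \<union> schur_support u) = 6" using m by linarith
        thus ?thesis unfolding l using q by simp
      next
        case 2
        hence "card (schur_support t \<union> schur_support u) = 5" "schur_support u \<inter> schur_support t \<noteq> {}"
          using m by auto
        thus ?thesis unfolding l using q by simp
      next
        case 3
        hence "?r = q ^ 6 + q ^ 5 + q ^ 3" by auto
        moreover have "q ^ card (schur_support t \<union> schur_support u) \<le> q ^ 3"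
          using m \<open>?m \<le> 3\<close> q by (intro power_decreasing) auto
        moreover have "q ^ 6 \<ge> 0" "q ^ 5 \<ge> 0" using q by auto
        ultimately show ?thesis unfolding l by linarith
      qed
    qed
    hence "(\<Sum>u\<in>S. ?P ({R. schur_support t \<subseteq> R} \<inter> {R. schur_support u \<subseteq> R})) \<le>
       (\<Sum>u\<in>S. q ^ 6 + (if schur_support u \<inter> schur_support t \<noteq> {} then q ^ 5 else 0)
          + (if card (schur_support u \<inter> schur_support t) \<ge> 2 then q ^ 3 else 0))"
      by (rule sum_mono)
    also have "\<dots> = s * q ^ 6 + real (card {u \<in> S. schur_support u \<inter> schur_support t \<noteq> {}}) * q ^ 5
        + real (card {u \<in> S. card (schur_support u \<inter> schur_support t) \<ge> 2}) * q ^ 3"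
      using finS by (simp add: sum.distrib sum.If_cases s_def Int_def)
    also have "\<dots> \<le> s * q ^ 6 + real (9 * n) * q ^ 5 + real 27 * q ^ 3"
      using card_triples_meeting[OF S_box, of "schur_support t"]
        card_triples_meeting_twice[of "schur_support t" S] c3[OF t] q
      by (intro add_mono mult_right_mono order_refl of_nat_mono) auto
    finally show ?thesis by simp
  qed
  have mu: "(\<Sum>t\<in>S. ?P {R. schur_support t \<subseteq> R}) = s * q ^ 3"
    using Pt by (simp add: s_def)
  have "(s * q ^ 3)\<^sup>2 * ?P {R. \<forall>t\<in>S. \<not> schur_support t \<subseteq> R} \<le>
      (\<Sum>t\<in>S. \<Sum>u\<in>S. ?P ({R. schur_support t \<subseteq> R} \<inter> {R. schur_support u \<subseteq> R})) - (s * q ^ 3)\<^sup>2"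
    using second_moment_bound[OF finS, of "binomial_random_subset n q" "\<lambda>t. {R. schur_support t \<subseteq> R}"] mu by simp
  also have "\<dots> \<le> (\<Sum>t\<in>S. s * q ^ 6 + 9 * n * q ^ 5 + 27 * q ^ 3) - (s * q ^ 3)\<^sup>2"
    by (intro diff_right_mono sum_mono row)
  also have "\<dots> = s * (s * q ^ 6 + 9 * n * q ^ 5 + 27 * q ^ 3) - (s * q ^ 3)\<^sup>2"
    by (simp add: s_def)
  also have "\<dots> = s * (9 * n * q ^ 5 + 27 * q ^ 3)"
    by (simp add: algebra_simps power2_eq_square flip: power_add)
  finally have "s\<^sup>2 * q ^ 6 * ?P {R. \<forall>t\<in>S. \<not> schur_support t \<subseteq> R} \<le> s * (9 * n * q ^ 5 + 27 * q ^ 3)"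
    by (simp add: power_mult_distrib flip: power_mult)
  hence "?P {R. \<forall>t\<in>S. \<not> schur_support t \<subseteq> R} \<le> s * (9 * n * q ^ 5 + 27 * q ^ 3) / (s\<^sup>2 * q ^ 6)"
    using s q by (simp add: pos_le_divide_eq mult.commute)
  also have "\<dots> = (9 * n / q + 27 / q ^ 3) / s"
    using s q by (simp add: field_simps power2_eq_square eval_nat_numeral)
  also have "\<dots> \<le> (9 * n / q + 27 / q ^ 3) / (\<gamma> * (real n)\<^sup>2)"
    using s q \<open>\<gamma> > 0\<close> n by (intro divide_left_mono mult_pos_pos) auto
  also have "\<dots> = (27 / ((real n)\<^sup>2 * q ^ 3) + 9 / (n * q)) / \<gamma>"
    using q \<open>\<gamma> > 0\<close> n by (simp add: field_simps power2_eq_square eval_nat_numeral)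
  finally show ?thesis .
qed

section \<open>Exposing the random set in two rounds\<close>

text \<open>
  An element is missed by both of two independent rounds of density \<open>q\<close> with probability
  \<open>(1 - q)\<^sup>2\<close>, independently of all other elements.
\<close>
lemma binomial_random_subset_two_rounds:
  assumes q: "0 \<le> q" "q \<le> 1"
  shows "binomial_random_subset n (1 - (1 - q)\<^sup>2) =
    bind_pmf (binomial_random_subset n q) (\<lambda>R. map_pmf (\<lambda>R'. R \<union> R') (binomial_random_subset n q))"
proof -
  have r: "0 \<le> (1 - q)\<^sup>2" "(1 - q)\<^sup>2 \<le> 1" using q by (auto simp: power_le_one)
  have "bernoulli_pmf (1 - (1 - q)\<^sup>2) =
      bind_pmf (bernoulli_pmf q) (\<lambda>a. map_pmf (\<lambda>b. a \<or> b) (bernoulli_pmf q))"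
  proof (rule pmf_eqI)
    fix b
    have "(1 - q)\<^sup>2 = (1 - q) * (1 - q)" by (simp add: power2_eq_square)
    hence "pmf (bernoulli_pmf (1 - (1 - q)\<^sup>2)) False =
        pmf (bind_pmf (bernoulli_pmf q) (\<lambda>a. map_pmf (\<lambda>b. a \<or> b) (bernoulli_pmf q))) False"
      using q r by (simp add: pmf_bind map_pmf_def measure_pmf_single)
    thus "pmf (bernoulli_pmf (1 - (1 - q)\<^sup>2)) b =
        pmf (bind_pmf (bernoulli_pmf q) (\<lambda>a. map_pmf (\<lambda>b. a \<or> b) (bernoulli_pmf q))) b"
      by (cases b) (simp_all add: pmf_True_conv_False)
  qed
  hence "Pi_pmf {1..n} False (\<lambda>_. bernoulli_pmf (1 - (1 - q)\<^sup>2)) =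
      bind_pmf (Pi_pmf {1..n} False (\<lambda>_. bernoulli_pmf q)) (\<lambda>f.
        bind_pmf (Pi_pmf {1..n} False (\<lambda>_. bernoulli_pmf q)) (\<lambda>g.
          return_pmf (\<lambda>k. if k \<in> {1..n} then f k \<or> g k else False)))"
    by (simp add: map_pmf_def Pi_pmf_bind[where d' = False] del: atLeastAtMost_iff)
  moreover have "{k \<in> {1..n}. if k \<in> {1..n} then f k \<or> g k else False} =
      {k \<in> {1..n}. f k} \<union> {k \<in> {1..n}. g k}" for f g :: "nat \<Rightarrow> bool" by auto
  ultimately show ?thesis
    unfolding binomial_random_subset_def
    by (simp add: map_pmf_def bind_assoc_pmf bind_return_pmf del: atLeastAtMost_iff)
qed

lemma prob_bind_compl_le:
  assumes M: "measure_pmf.prob M (- G) \<le> \<epsilon>" and K: "\<And>x. x \<in> G \<Longrightarrow> measure_pmf.prob (K x) (- H) \<le> \<delta>"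
    and "0 \<le> \<delta>"
  shows "measure_pmf.prob (bind_pmf M K) (- H) \<le> \<epsilon> + \<delta>"
proof -
  have "0 \<le> \<epsilon>" using M measure_nonneg[of "measure_pmf M" "- G"] by linarith
  have "emeasure (bind_pmf M K) (- H) = (\<integral>\<^sup>+x. emeasure (K x) (- H) \<partial>M)" by simp
  also have "\<dots> \<le> (\<integral>\<^sup>+x. indicator (- G) x + ennreal \<delta> \<partial>M)"
  proof (rule nn_integral_mono)
    fix x
    show "emeasure (K x) (- H) \<le> indicator (- G) x + ennreal \<delta>"
    proof (cases "x \<in> G")
      case True
      thus ?thesis using K[OF True] by (simp add: measure_pmf.emeasure_eq_measure ennreal_leI)
    next
      case False
      thus ?thesis by (simp add: add_increasing2 measure_pmf.emeasure_le_1)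
    qed
  qed
  also have "\<dots> = emeasure M (- G) + ennreal \<delta>"
    by (subst nn_integral_add) auto
  also have "\<dots> \<le> ennreal (\<epsilon> + \<delta>)"
    using M \<open>0 \<le> \<delta>\<close> \<open>0 \<le> \<epsilon>\<close> by (simp add: measure_pmf.emeasure_eq_measure ennreal_leI flip: ennreal_plus)
  finally show ?thesis
    using \<open>0 \<le> \<delta>\<close> \<open>0 \<le> \<epsilon>\<close>
    by (simp add: measure_pmf.emeasure_eq_measure ennreal_le_iff del: ennreal_plus)
qed

definition popular_miss_bound :: "real \<Rightarrow> nat \<Rightarrow> real \<Rightarrow> real" where
  "popular_miss_bound \<gamma> n q = (27 / ((real n)\<^sup>2 * q ^ 3) + 9 / (n * q)) / \<gamma>"

lemma prob_no_popular_pair_le: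
  fixes q \<gamma> :: real
  assumes q: "0 < q" "q \<le> 1" and "\<gamma> > 0" and n: "n > 0"
    and many: "real (card (popular_pairs n \<gamma> A)) \<ge> \<gamma> * (real n)\<^sup>2"
  shows "measure_pmf.prob (binomial_random_subset n q)
     (- {R. \<exists>t\<in>popular_pairs n \<gamma> A. schur_support t \<subseteq> R}) \<le> popular_miss_bound \<gamma> n q"
proof -
  have "- {R. \<exists>t\<in>popular_pairs n \<gamma> A. schur_support t \<subseteq> R} =
      {R. \<forall>t\<in>popular_pairs n \<gamma> A. \<not> schur_support t \<subseteq> R}" by auto
  thus ?thesis
    using prob_no_schur_triple_le[OF _ q \<open>\<gamma> > 0\<close> n many]
    by (simp add: popular_pairs_def popular_miss_bound_def)
qed

text \<open>
  The first round finds a popular pair of \<open>A\<close>. Its set of base points has density at least \<open>\<gamma>\<close>,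
  and \<open>\<gamma>'\<close> is the constant that belongs to this density. For every outcome of a successful first
  round, the second round finds a popular pair of the set of base points, except with the
  probability bounded by the second summand.
\<close>
lemma prob_not_two_colour_schur_le:
  fixes \<alpha> :: real
  assumes "\<alpha> > 0"
  obtains \<gamma> \<gamma>' N where "\<gamma> > 0" "\<gamma>' > 0"
    "\<And>n A q. n \<ge> N \<Longrightarrow> A \<subseteq> {1..n} \<Longrightarrow> real (card A) \<ge> \<alpha> * n \<Longrightarrow> 0 < q \<Longrightarrow> q \<le> 1 \<Longrightarrow>
       measure_pmf.prob (binomial_random_subset n (1 - (1 - q)\<^sup>2)) (- {R. two_colour_schur (A \<union> R)})
         \<le> popular_miss_bound \<gamma> n q + popular_miss_bound \<gamma>' n q"
proof -
  obtain \<gamma> N where g: "\<gamma> > 0" "\<And>n A. n \<ge> N \<Longrightarrow> A \<subseteq> {1..n} \<Longrightarrow> real (card A) \<ge> \<alpha> * n \<Longrightarrow>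
       real (card (popular_pairs n \<gamma> A)) \<ge> \<gamma> * (real n)\<^sup>2"
    using many_popular_pairs[OF assms] by blast
  obtain \<gamma>' N' where g': "\<gamma>' > 0" "\<And>n A. n \<ge> N' \<Longrightarrow> A \<subseteq> {1..n} \<Longrightarrow> real (card A) \<ge> \<gamma> * n \<Longrightarrow>
       real (card (popular_pairs n \<gamma>' A)) \<ge> \<gamma>' * (real n)\<^sup>2"
    using many_popular_pairs[OF g(1)] by blast
  have "measure_pmf.prob (binomial_random_subset n (1 - (1 - q)\<^sup>2)) (- {R. two_colour_schur (A \<union> R)})
         \<le> popular_miss_bound \<gamma> n q + popular_miss_bound \<gamma>' n q"
    if n: "n \<ge> N + N' + 1" and A: "A \<subseteq> {1..n}" and dens: "real (card A) \<ge> \<alpha> * n" and q: "0 < q" "q \<le> 1"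
    for n A q
  proof -
    have n0: "n > 0" "n \<ge> N" "n \<ge> N'" using n by auto
    define G where "G = {R. \<exists>t\<in>popular_pairs n \<gamma> A. schur_support t \<subseteq> R}"
    have bound_nonneg: "popular_miss_bound \<gamma>' n q \<ge> 0"
      using q g'(1) by (simp add: popular_miss_bound_def)
    have first: "measure_pmf.prob (binomial_random_subset n q) (- G) \<le> popular_miss_bound \<gamma> n q"
      unfolding G_def by (rule prob_no_popular_pair_le[OF q g(1) n0(1) g(2)[OF n0(2) A dens]])
    have second: "measure_pmf.prob (map_pmf (\<lambda>R'. R \<union> R') (binomial_random_subset n q))
        (- {R. two_colour_schur (A \<union> R)}) \<le> popular_miss_bound \<gamma>' n q" if "R \<in> G" for R
    proof -
      from that obtain x y where xy: "(x, y) \<in> popular_pairs n \<gamma> A" "{x, y, x + y} \<subseteq> R"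
        by (auto simp: G_def schur_support_def)
      define B where "B = box_corners A x y"
      have B: "B \<subseteq> {1..n}" "real (card B) \<ge> \<gamma> * n"
        using xy(1) A box_corners_subset[of A x y] by (auto simp: B_def popular_pairs_def)
      have "two_colour_schur (A \<union> (R \<union> R'))"
        if t: "t \<in> popular_pairs n \<gamma>' B" "schur_support t \<subseteq> R'" for t R'
      proof -
        obtain u v where uv: "t = (u, v)" by (cases t)
        have "real (card (box_corners B u v)) \<ge> \<gamma>' * n" using t(1) by (simp add: uv popular_pairs_def)
        hence "card (box_corners B u v) > 0"
          using g'(1) n0(1) by (smt (verit) mult_pos_pos of_nat_0_less_iff)
        hence "box_corners (box_corners A x y) u v \<noteq> {}" by (auto simp: B_def)
        thus ?thesis
          using xy(2) t(2) by (intro two_nested_boxes_imp_schur[of A _ x y u v]) (auto simp: uv schur_support_def)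
      qed
      hence "(\<lambda>R'. R \<union> R') -` (- {R. two_colour_schur (A \<union> R)}) \<subseteq>
          - {R'. \<exists>t\<in>popular_pairs n \<gamma>' B. schur_support t \<subseteq> R'}" by auto
      hence "measure_pmf.prob (map_pmf (\<lambda>R'. R \<union> R') (binomial_random_subset n q))
          (- {R. two_colour_schur (A \<union> R)}) \<le> measure_pmf.prob (binomial_random_subset n q)
            (- {R'. \<exists>t\<in>popular_pairs n \<gamma>' B. schur_support t \<subseteq> R'})"
        by (simp add: measure_pmf.finite_measure_mono)
      also have "\<dots> \<le> popular_miss_bound \<gamma>' n q"
        by (rule prob_no_popular_pair_le[OF q g'(1) n0(1) g'(2)[OF n0(3) B]])
      finally show ?thesis .
    qed
    show ?thesis
      using prob_bind_compl_le[OF first second bound_nonneg] q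
      by (simp add: binomial_random_subset_two_rounds)
  qed
  thus ?thesis using that[OF g(1) g'(1)] by blast
qed

text \<open>
  With \<open>w = p n^(2/3)\<close>, the quantity \<open>n\<^sup>2 p\<^sup>3\<close>, which is the order of the expected number of
  triples, equals \<open>w\<^sup>3\<close>, and \<open>n p \<ge> w\<close>. So the failure probability is controlled by \<open>w\<close> alone.
\<close>
lemma popular_miss_bound_le:
  fixes p q :: real
  assumes "\<gamma> > 0" "n > 0" "p > 0" "q \<ge> p / 2"
  defines "w \<equiv> p * real n powr (2/3)"
  shows "popular_miss_bound \<gamma> n q \<le> (216 / w ^ 3 + 18 / w) / \<gamma>"
proof -
  have w: "w > 0" using assms by (simp add: w_def)
  have "w ^ 3 = p ^ 3 * (real n)\<^sup>2"
    using \<open>n > 0\<close> by (simp add: w_def power_mult_distrib powr_power)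
  moreover have "p ^ 3 / 8 \<le> q ^ 3"
    using power_mono[OF assms(4), of 3] \<open>p > 0\<close> by (simp add: power_divide)
  ultimately have "(real n)\<^sup>2 * q ^ 3 \<ge> w ^ 3 / 8"
    using mult_left_mono[of "p ^ 3 / 8" "q ^ 3" "(real n)\<^sup>2"] by (simp add: mult_ac)
  hence a: "27 / ((real n)\<^sup>2 * q ^ 3) \<le> 27 / (w ^ 3 / 8)"
    using w by (intro frac_le) auto
  have "real n powr (2/3) \<le> real n powr 1" using \<open>n > 0\<close> by (intro powr_mono) auto
  hence "w \<le> p * n" using \<open>p > 0\<close> by (simp add: w_def)
  also have "p * n \<le> 2 * (n * q)" using assms(4) mult_left_mono[of "p / 2" q "real n"] by (simp add: mult_ac)
  finally have "9 / (n * q) \<le> 9 / (w / 2)" using w by (intro frac_le) auto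
  with a show ?thesis unfolding popular_miss_bound_def
    using \<open>\<gamma> > 0\<close> by (intro divide_right_mono) auto
qed

section \<open>Randomly perturbed dense sets\<close>

theorem theorem1:
  fixes \<alpha> :: real and p :: "nat \<Rightarrow> real" and A :: "nat \<Rightarrow> nat set"
  assumes "\<alpha> > 0"
    and "\<And>n. p n \<in> {0..1}"
    and "filterlim (\<lambda>n. p n * real n powr (2/3)) at_top sequentially"
    and "\<And>n. A n \<subseteq> {1..n}"
    and "\<And>n. real (card (A n)) \<ge> \<alpha> * real n"
  shows "(\<lambda>n. measure_pmf.prob (binomial_random_subset n (p n))
            {R. two_colour_schur (A n \<union> R)}) \<longlonglongrightarrow> 1"
proof -
  define w where "w n = p n * real n powr (2/3)" for n
  define f where "f n = measure_pmf.prob (binomial_random_subset n (p n))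
      (- {R. two_colour_schur (A n \<union> R)})" for n
  obtain \<gamma> \<gamma>' N where g: "\<gamma> > 0" "\<gamma>' > 0"
    "\<And>n A q. n \<ge> N \<Longrightarrow> A \<subseteq> {1..n} \<Longrightarrow> real (card A) \<ge> \<alpha> * n \<Longrightarrow> 0 < q \<Longrightarrow> q \<le> 1 \<Longrightarrow>
       measure_pmf.prob (binomial_random_subset n (1 - (1 - q)\<^sup>2)) (- {R. two_colour_schur (A \<union> R)})
         \<le> popular_miss_bound \<gamma> n q + popular_miss_bound \<gamma>' n q"
    using prob_not_two_colour_schur_le[OF assms(1)] by blast
  have bound: "f n \<le> (216 / w n ^ 3 + 18 / w n) / \<gamma> + (216 / w n ^ 3 + 18 / w n) / \<gamma>'"
    if n: "n \<ge> N" "w n > 0" for n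
  proof -
    (* The density of each of the two rounds, so that (1 - q)^2 = 1 - p n. *)
    define q where "q = 1 - sqrt (1 - p n)"
    have p01: "0 \<le> p n" "p n \<le> 1" using assms(2)[of n] by auto
    have np: "n > 0" "p n > 0" using n(2) p01 by (auto simp: w_def zero_less_mult_iff intro!: Nat.gr0I)
    have "1 - (1 - q)\<^sup>2 = p n" using p01 by (simp add: q_def)
    moreover have q1: "q \<le> 1" using p01 by (simp add: q_def)
    moreover have q_half: "q \<ge> p n / 2"
    proof -
      have "sqrt (1 - p n) \<le> 1 - p n / 2"
        using p01 by (intro real_le_lsqrt) (auto simp: power2_eq_square field_simps)
      thus ?thesis by (simp add: q_def)
    qed
    moreover have "q > 0" using q_half np by linarith
    ultimately have "f n \<le> popular_miss_bound \<gamma> n q + popular_miss_bound \<gamma>' n q"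
      using g(3)[OF n(1) assms(4,5), of q] by (simp add: f_def)
    thus ?thesis
      using popular_miss_bound_le[OF g(1) np q_half] popular_miss_bound_le[OF g(2) np q_half]
      by (simp add: w_def)
  qed
  have lim_w: "filterlim w at_top sequentially" using assms(3) by (simp add: w_def[abs_def])
  have "((\<lambda>x::real. (216 / x ^ 3 + 18 / x) / \<gamma> + (216 / x ^ 3 + 18 / x) / \<gamma>') \<longlongrightarrow> 0) at_top"
    using g(1,2) by real_asymp
  from filterlim_compose[OF this lim_w]
  have lim: "(\<lambda>n. (216 / w n ^ 3 + 18 / w n) / \<gamma> + (216 / w n ^ 3 + 18 / w n) / \<gamma>') \<longlonglongrightarrow> 0" .
  have "f \<longlonglongrightarrow> 0"
  proof (rule tendsto_sandwich[OF _ _ tendsto_const lim])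
    show "\<forall>\<^sub>F n in sequentially. 0 \<le> f n" by (simp add: f_def)
    have "\<forall>\<^sub>F n in sequentially. w n > 0" using lim_w by (simp add: filterlim_at_top_dense)
    with eventually_ge_at_top[of N]
    show "\<forall>\<^sub>F n in sequentially. f n \<le> (216 / w n ^ 3 + 18 / w n) / \<gamma> + (216 / w n ^ 3 + 18 / w n) / \<gamma>'"
      by eventually_elim (rule bound)
  qed
  hence "(\<lambda>n. 1 - f n) \<longlonglongrightarrow> 1 - 0" by (intro tendsto_diff tendsto_const)
  moreover have "1 - f n = measure_pmf.prob (binomial_random_subset n (p n))
      {R. two_colour_schur (A n \<union> R)}" for n
    using measure_pmf.prob_compl[of "{R. two_colour_schur (A n \<union> R)}" "binomial_random_subset n (p n)"]
    by (simp add: f_def Compl_eq_Diff_UNIV)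
  ultimately show ?thesis by simp
qed

end
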